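(* $\mathsf{Diff}^\ast(\boldsymbol{\Pi}^1_1)\subsetneq\boldsymbol{\Delta}^0_1(\boldsymbol{\Pi}^1_1\cup\boldsymbol{\Sigma}^1_1)$.
   Context: Sets are subsets of Baire space $\omega^\omega$. An ordinal $\lambda+n$ ($\lambda$ zero or limit, $n<\omega$) is even/odd according to the parity of $n$. For a countable ordinal $\xi$ and a decreasing sequence $(B_\eta)_{\eta<\xi}$ of sets, $$\mathbb{D}^\ast_{\eta<\xi}B_\eta=\bigcup_{\eta<\xi,\ \eta\text{ even}}(B_\eta\setminus B_{\eta+1}),$$ where, if $\xi$ is odd, $B_\xi:=\emptyset$. $D^\ast_\xi(\boldsymbol{\Pi}^1_1)$ is the class of all sets $\mathbb{D}^\ast_{\eta<\xi}B_\eta$ for decreasing sequences of $\boldsymbol{\Pi}^1_1$ sets, and $\mathsf{Diff}^\ast(\boldsymbol{\Pi}^1_1)=\bigcup_{\xi<\omega_1}D^\ast_\xi(\boldsymbol{\Pi}^1_1)$. For a pointclass $\Gamma$, $\boldsymbol{\Sigma}^0_1(\Gamma)$ is the smallest family including all $\Gamma$ sets and closed under countable union, finite intersection, and continuous preimage; a set $A$ is in $\boldsymbol{\Delta}^0_1(\Gamma)$ if both $A$ and its complement are in $\boldsymbol{\Sigma}^0_1(\Gamma)$. *)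

theory Defs
  imports "HOL-Analysis.Function_Topology" "HOL-Library.Countable_Set"
begin

text \<open>
  The type \<open>omega1\<close> is the first uncountable cardinal, realised as the field of the
  cardinal successor of \<open>natLeq\<close>. Its elements are the countable ordinals: it is a
  well-order in which every proper initial segment is countable, and it is itself
  uncountable, which determines it up to order isomorphism.
\<close>

typedef omega1 = "Field (cardSuc natLeq)"
proof -
  have "infinite (Field (cardSuc natLeq))"
    using cardSuc_finite[OF natLeq_Card_order] by (simp add: Field_natLeq)
  then show ?thesis
    by (metis ex_in_conv finite.emptyI)
qed

lemma Well_order_cardSuc_natLeq: "Well_order (cardSuc natLeq)"
  using cardSuc_Card_order[OF natLeq_Card_order] card_order_on_def by blast

instantiation omega1 :: wellorder
begin

definition less_eq_omega1 :: "omega1 \<Rightarrow> omega1 \<Rightarrow> bool" where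
  "x \<le> y \<longleftrightarrow> (Rep_omega1 x, Rep_omega1 y) \<in> cardSuc natLeq"

definition less_omega1 :: "omega1 \<Rightarrow> omega1 \<Rightarrow> bool" where
  "x < y \<longleftrightarrow> x \<le> y \<and> \<not> y \<le> x" for x y :: omega1

instance
proof
  interpret wo_rel "cardSuc natLeq"
    using Well_order_cardSuc_natLeq by (simp add: wo_rel_def)
  fix x y z :: omega1
  show "x < y \<longleftrightarrow> x \<le> y \<and> \<not> y \<le> x"
    by (rule less_omega1_def)
  show "x \<le> x"
    unfolding less_eq_omega1_def using REFL Rep_omega1[of x] by (auto simp: refl_on_def)
  show "x \<le> z" if "x \<le> y" "y \<le> z"
    using that TRANS unfolding less_eq_omega1_def by (meson transD)
  show "x = y" if "x \<le> y" "y \<le> x"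
    using that ANTISYM unfolding less_eq_omega1_def
    by (metis Rep_omega1_inject antisymD)
  show "x \<le> y \<or> y \<le> x"
    using TOTALS Rep_omega1 unfolding less_eq_omega1_def by blast
next
  interpret wo_rel "cardSuc natLeq"
    using Well_order_cardSuc_natLeq by (simp add: wo_rel_def)
  fix P :: "omega1 \<Rightarrow> bool" and a :: omega1
  assume step: "\<And>x. (\<And>y. y < x \<Longrightarrow> P y) \<Longrightarrow> P x"
  have wfS: "wf (cardSuc natLeq - Id)"
    using WELL well_order_on_def by blast
  have "wf {(x, y). x < (y :: omega1)}"
  proof (rule wf_subset[OF wf_inv_image[OF wfS, of Rep_omega1]])
    show "{(x, y). x < (y :: omega1)} \<subseteq> inv_image (cardSuc natLeq - Id) Rep_omega1"
      by (auto simp: inv_image_def less_omega1_def less_eq_omega1_def Rep_omega1_inject)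
  qed
  then show "P a"
    by (rule wf_induct_rule) (use step in auto)
qed

end

lemma countable_lessThan_omega1:
  includes cardinal_syntax
  shows "countable {..<a :: omega1}"
proof -
  let ?r = "cardSuc natLeq"
  have co: "Card_order ?r"
    by (rule cardSuc_Card_order[OF natLeq_Card_order])
  have "|underS ?r (Rep_omega1 a)| <o ?r"
    by (rule card_of_underS[OF co Rep_omega1])
  then have "|underS ?r (Rep_omega1 a)| \<le>o natLeq"
    using cardSuc_ordLeq_ordLess[OF natLeq_Card_order card_of_Card_order] by blast
  then have "|underS ?r (Rep_omega1 a)| \<le>o |UNIV :: nat set|"
    using card_of_nat ordIso_symmetric ordLeq_ordIso_trans by blast
  then obtain f :: "nat set \<Rightarrow> nat" where "inj_on f (underS ?r (Rep_omega1 a))"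
    unfolding card_of_ordLeq[symmetric] by auto
  then have "countable (underS ?r (Rep_omega1 a))"
    by (auto simp: countable_def)
  moreover have "Rep_omega1 ` {..<a} \<subseteq> underS ?r (Rep_omega1 a)"
    by (auto simp: underS_def less_omega1_def less_eq_omega1_def)
  ultimately have "countable (Rep_omega1 ` {..<a})"
    using countable_subset by blast
  then show ?thesis
    by (rule countable_image_inj_on) (auto simp: inj_on_def Rep_omega1_inject)
qed

lemma uncountable_omega1:
  includes cardinal_syntax
  shows "uncountable (UNIV :: omega1 set)"
proof
  let ?r = "cardSuc natLeq"
  have co: "Card_order ?r"
    by (rule cardSuc_Card_order[OF natLeq_Card_order])
  assume "countable (UNIV :: omega1 set)"
  then have "countable (range Rep_omega1)"
    by blast
  then have "countable (Field ?r)"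
    by (simp add: type_definition.Rep_range[OF type_definition_omega1])
  then obtain f :: "nat set \<Rightarrow> nat" where "inj_on f (Field ?r)"
    by (auto simp: countable_def)
  then have "|Field ?r| \<le>o |UNIV :: nat set|"
    unfolding card_of_ordLeq[symmetric] by auto
  then have "?r \<le>o natLeq"
    using card_of_Field_ordIso[OF co] card_of_nat ordIso_symmetric
      ordIso_ordLeq_trans ordLeq_ordIso_trans by metis
  moreover have "natLeq <o ?r"
    by (rule cardSuc_greater[OF natLeq_Card_order])
  ultimately show False
    using not_ordLess_ordLeq by blast
qed

definition ord_suc :: "omega1 \<Rightarrow> omega1" where
  "ord_suc \<eta> = (LEAST \<zeta>. \<eta> < \<zeta>)"

lemma less_ord_suc: "\<eta> < ord_suc \<eta>"
proof -
  have "{..\<eta>} = insert \<eta> {..<\<eta>}"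
    by auto
  then have "countable {..\<eta>}"
    using countable_lessThan_omega1[of \<eta>] by simp
  then have "{..\<eta>} \<noteq> UNIV"
    using uncountable_omega1 by auto
  then have "\<exists>\<zeta>. \<eta> < \<zeta>"
    by (auto simp: not_le)
  then show ?thesis
    unfolding ord_suc_def by (rule LeastI_ex)
qed

definition zero_or_limit :: "omega1 \<Rightarrow> bool" where
  "zero_or_limit \<alpha> \<longleftrightarrow> (\<forall>\<beta><\<alpha>. ord_suc \<beta> < \<alpha>)"

definition ord_even :: "omega1 \<Rightarrow> bool" where
  "ord_even \<alpha> \<longleftrightarrow> (\<exists>\<mu> n. zero_or_limit \<mu> \<and> even n \<and> \<alpha> = (ord_suc ^^ n) \<mu>)"

text \<open>Baire space carries the product topology of the discrete space \<open>nat\<close>.\<close>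

type_synonym baire = "nat \<Rightarrow> nat"

definition Sigma11 :: "baire set set" where
  "Sigma11 = {fst ` C | C :: (baire \<times> baire) set. closed C}"

definition Pi11 :: "baire set set" where
  "Pi11 = {A. - A \<in> Sigma11}"

inductive_set Sigma01 :: "baire set set \<Rightarrow> baire set set" for \<Gamma> :: "baire set set" where
  base: "A \<in> \<Gamma> \<Longrightarrow> A \<in> Sigma01 \<Gamma>"
| countable_Union: "(\<And>n :: nat. A n \<in> Sigma01 \<Gamma>) \<Longrightarrow> (\<Union>n. A n) \<in> Sigma01 \<Gamma>"
| Inter: "A \<in> Sigma01 \<Gamma> \<Longrightarrow> B \<in> Sigma01 \<Gamma> \<Longrightarrow> A \<inter> B \<in> Sigma01 \<Gamma>"
| continuous_vimage:
    "A \<in> Sigma01 \<Gamma> \<Longrightarrow> continuous_on UNIV f \<Longrightarrow> f -` A \<in> Sigma01 \<Gamma>"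

definition Delta01 :: "baire set set \<Rightarrow> baire set set" where
  "Delta01 \<Gamma> = {A. A \<in> Sigma01 \<Gamma> \<and> - A \<in> Sigma01 \<Gamma>}"

text \<open>
  A sequence of length \<open>\<xi>\<close> is a function on \<open>omega1\<close> of which only the values below \<open>\<xi>\<close>
  matter. The value at \<open>\<xi>\<close> is set to the empty set; it is consulted only if
  \<open>\<xi> = \<eta> + 1\<close> with \<open>\<eta>\<close> even, that is, if \<open>\<xi>\<close> is odd.
\<close>

definition Diff_op :: "omega1 \<Rightarrow> (omega1 \<Rightarrow> baire set) \<Rightarrow> baire set" where
  "Diff_op \<xi> B = (\<Union>\<eta> \<in> {\<eta>. \<eta> < \<xi> \<and> ord_even \<eta>}. B \<eta> - (B(\<xi> := {})) (ord_suc \<eta>))"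

definition Diff_level :: "omega1 \<Rightarrow> baire set set \<Rightarrow> baire set set" where
  "Diff_level \<xi> \<Gamma> =
     {Diff_op \<xi> B | B. (\<forall>\<eta><\<xi>. B \<eta> \<in> \<Gamma>) \<and> (\<forall>\<eta> \<zeta>. \<eta> \<le> \<zeta> \<and> \<zeta> < \<xi> \<longrightarrow> B \<zeta> \<subseteq> B \<eta>)}"

definition Diff_star :: "baire set set \<Rightarrow> baire set set" where
  "Diff_star \<Gamma> = (\<Union>\<xi>. Diff_level \<xi> \<Gamma>)"

end

theory Submission
  imports Defs
begin

text \<open>
  For a decreasing sequence of length \<open>\<xi>\<close>, extended by the empty set at \<open>\<xi>\<close>, a point belongs
  to the difference iff the least index at which it has left the sequence is odd. Hence both the
  difference and its complement are countable unions of intersections of a coanalytic with an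
  analytic set.

  For strictness, let \<open>z\<close> code a relation on the natural numbers, a sequence of coanalytic sets
  indexed by them, and a parity for each index. The set of all \<open>z\<close> whose relation is a well-order
  and for which the least index whose set omits \<open>z\<close> has even parity is again such a countable
  union, and so is its complement, since being a well-order is coanalytic. If it were the
  difference of a sequence \<open>B\<close>, a code \<open>z\<close> of \<open>B\<close> itself with the true parities would first
  leave \<open>B\<close> at an index that is both even and odd.
\<close>

section \<open>Parity of countable ordinals\<close>

lemma ord_suc_le_iff: "ord_suc \<eta> \<le> \<zeta> \<longleftrightarrow> \<eta> < \<zeta>"
  using less_ord_suc[of \<eta>] by (auto simp: ord_suc_def intro: Least_le)

lemma less_ord_suc_iff: "\<zeta> < ord_suc \<eta> \<longleftrightarrow> \<zeta> \<le> \<eta>"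
  using ord_suc_le_iff[of \<eta> \<zeta>] by (auto simp: not_le[symmetric])

lemma ord_suc_inject [simp]: "ord_suc \<eta> = ord_suc \<zeta> \<longleftrightarrow> \<eta> = \<zeta>"
  by (metis less_ord_suc less_ord_suc_iff order_antisym)

lemma not_zero_or_limit_ord_suc [simp]: "\<not> zero_or_limit (ord_suc \<eta>)"
  using less_ord_suc by (auto simp: zero_or_limit_def)

lemma not_zero_or_limitE:
  assumes "\<not> zero_or_limit \<eta>"
  obtains \<beta> where "\<eta> = ord_suc \<beta>"
  using assms by (metis zero_or_limit_def ord_suc_le_iff not_less order_antisym)

lemma ord_decomp: "\<exists>\<mu> n. zero_or_limit \<mu> \<and> \<eta> = (ord_suc ^^ n) \<mu>"
proof (induction \<eta> rule: less_induct)
  case (less \<eta>)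
  show ?case
  proof (cases "zero_or_limit \<eta>")
    case True
    then show ?thesis
      by (metis funpow_0)
  next
    case False
    then obtain \<beta> where \<beta>: "\<eta> = ord_suc \<beta>"
      by (rule not_zero_or_limitE)
    with less[of \<beta>] obtain \<mu> n where "zero_or_limit \<mu>" "\<beta> = (ord_suc ^^ n) \<mu>"
      using less_ord_suc by blast
    with \<beta> have "zero_or_limit \<mu> \<and> \<eta> = (ord_suc ^^ Suc n) \<mu>"
      by simp
    then show ?thesis
      by blast
  qed
qed

text \<open>\<open>ord_even\<close> asks only for some decomposition, so parity is well defined
  because the exponent is unique: successors cancel on both sides until one side is zero or a limit,
  hence not a successor.\<close>

lemma ord_decomp_unique:
  assumes "zero_or_limit \<mu>" "zero_or_limit \<nu>" "(ord_suc ^^ m) \<mu> = (ord_suc ^^ n) \<nu>"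
  shows "m = n"
  using assms(3)
proof (induction m arbitrary: n)
  case 0
  then show ?case
    using assms(1) by (cases n) auto
next
  case (Suc m)
  then show ?case
    using assms(2) by (cases n) auto
qed

lemma ord_even_ord_suc [simp]: "ord_even (ord_suc \<eta>) \<longleftrightarrow> \<not> ord_even \<eta>"
proof -
  obtain \<mu> n where \<mu>: "zero_or_limit \<mu>" "\<eta> = (ord_suc ^^ n) \<mu>"
    using ord_decomp by blast
  have "ord_even ((ord_suc ^^ k) \<mu>) \<longleftrightarrow> even k" for k
    using \<mu>(1) ord_decomp_unique unfolding ord_even_def by blast
  from this[of n] this[of "Suc n"] show ?thesis
    using \<mu>(2) by simp
qed

lemma odd_ordE:
  assumes "\<not> ord_even \<eta>"
  obtains \<beta> where "\<eta> = ord_suc \<beta>" "ord_even \<beta>"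
proof -
  have "\<not> zero_or_limit \<eta>"
    using assms unfolding ord_even_def by (metis even_zero funpow_0)
  then show thesis
    using assms that by (metis not_zero_or_limitE ord_even_ord_suc)
qed

text \<open>If \<open>x\<close> lies in the block at \<open>\<beta>\<close>, then
  \<open>ord_suc \<beta>\<close> is the first index omitting \<open>x\<close>: monotonicity excludes
  the blocks from the exit onwards, and before the exit \<open>x\<close> still lies in the next
  set.\<close>

lemma mem_Diff_op_iff:
  assumes "\<forall>\<eta> \<zeta>. \<eta> \<le> \<zeta> \<and> \<zeta> < \<xi> \<longrightarrow> B \<zeta> \<subseteq> B \<eta>"
    and "x \<notin> (B(\<xi> := {})) \<eta>" and "\<eta> \<le> \<xi>" and "\<forall>\<zeta><\<eta>. x \<in> B \<zeta>"
  shows "x \<in> Diff_op \<xi> B \<longleftrightarrow> \<not> ord_even \<eta>"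
proof
  assume "x \<in> Diff_op \<xi> B"
  then obtain \<beta> where \<beta>: "\<beta> < \<xi>" "ord_even \<beta>" "x \<in> B \<beta>" "x \<notin> (B(\<xi> := {})) (ord_suc \<beta>)"
    unfolding Diff_op_def by blast
  have "\<beta> < \<eta>"
  proof (rule ccontr)
    assume "\<not> \<beta> < \<eta>"
    then have "\<eta> \<le> \<beta>"
      by simp
    then show False
      using assms(1)[rule_format, of \<eta> \<beta>] assms(2) \<beta> by (auto split: if_splits)
  qed
  moreover have "\<not> ord_suc \<beta> < \<eta>"
    using assms(3) assms(4)[rule_format, of "ord_suc \<beta>"] \<beta>(4) by (auto split: if_splits)
  ultimately have "\<eta> = ord_suc \<beta>"
    by (intro order_antisym) (auto simp: ord_suc_le_iff not_less)
  then show "\<not> ord_even \<eta>"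
    using \<beta>(2) by simp
next
  assume "\<not> ord_even \<eta>"
  then obtain \<beta> where "\<eta> = ord_suc \<beta>" "ord_even \<beta>"
    by (rule odd_ordE)
  then show "x \<in> Diff_op \<xi> B"
    using assms(2-4) less_ord_suc[of \<beta>] unfolding Diff_op_def by fastforce
qed

text \<open>The empty set placed at \<open>\<xi>\<close> forces an exit even for a point lying in
  all sets of the sequence.\<close>

lemma first_exit_exists:
  fixes \<xi> :: omega1
  obtains \<eta> where "x \<notin> (B(\<xi> := {})) \<eta>" "\<eta> \<le> \<xi>" "\<forall>\<zeta><\<eta>. x \<in> B \<zeta>"
proof -
  define \<eta> where "\<eta> = (LEAST \<eta>. x \<notin> (B(\<xi> := {})) \<eta>)"
  have \<xi>: "x \<notin> (B(\<xi> := {})) \<xi>"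
    by simp
  have "x \<notin> (B(\<xi> := {})) \<eta>"
    unfolding \<eta>_def using \<xi> by (rule LeastI)
  moreover have le: "\<eta> \<le> \<xi>"
    unfolding \<eta>_def using \<xi> by (rule Least_le)
  moreover have "\<forall>\<zeta><\<eta>. x \<in> B \<zeta>"
  proof (intro allI impI)
    fix \<zeta>
    assume that: "\<zeta> < \<eta>"
    have "x \<in> (B(\<xi> := {})) \<zeta>"
      using not_less_Least[OF that[unfolded \<eta>_def]] by blast
    then show "x \<in> B \<zeta>"
      using that le by (simp split: if_splits)
  qed
  ultimately show thesis
    by (rule that)
qed

lemma Diff_starE:
  assumes "A \<in> Diff_star \<Gamma>"
  obtains \<xi> B where "A = Diff_op \<xi> B" "\<forall>\<eta><\<xi>. B \<eta> \<in> \<Gamma>"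
    "\<forall>\<eta> \<zeta>. \<eta> \<le> \<zeta> \<and> \<zeta> < \<xi> \<longrightarrow> B \<zeta> \<subseteq> B \<eta>"
proof -
  obtain \<xi> where "A \<in> Diff_level \<xi> \<Gamma>"
    using assms unfolding Diff_star_def by (rule UN_E)
  then show thesis
    using that unfolding Diff_level_def mem_Collect_eq by metis
qed

section \<open>Closure properties\<close>

lemma Sigma11I: "closed C \<Longrightarrow> fst ` C \<in> Sigma11" for C :: "(baire \<times> baire) set"
  unfolding Sigma11_def by blast

lemma Sigma11E:
  assumes "A \<in> Sigma11"
  obtains C :: "(baire \<times> baire) set" where "closed C" "A = fst ` C"
  using assms unfolding Sigma11_def by blast

lemma Compl_Pi11_iff [simp]: "- A \<in> Pi11 \<longleftrightarrow> A \<in> Sigma11"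
  by (simp add: Pi11_def)

lemma Compl_Sigma11_iff: "- A \<in> Sigma11 \<longleftrightarrow> A \<in> Pi11"
  by (simp add: Pi11_def)

lemma
  fixes f :: "'a::topological_space \<Rightarrow> nat"
  assumes "continuous_on UNIV f"
  shows open_Collect_nat_eq: "open {x. f x = c}"
    and closed_Collect_nat_eq: "closed {x. f x = c}"
    and closed_Collect_nat_neq: "closed {x. f x \<noteq> c}"
proof -
  have clopen: "open (f -` N)" "closed (f -` N)" for N
    using assms by (auto simp: open_discrete closed_def intro!: open_vimage closed_vimage)
  show "open {x. f x = c}" "closed {x. f x = c}" "closed {x. f x \<noteq> c}"
    using clopen[of "{c}"] clopen[of "- {c}"] by (simp_all add: vimage_def)
qed

lemma continuous_on_fst_coord [continuous_intros]:
  "continuous_on UNIV (\<lambda>p :: baire \<times> baire. fst p i)"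
  by (rule continuous_on_product_then_coordinatewise[OF continuous_on_fst[OF continuous_on_id]])

lemma continuous_on_snd_coord [continuous_intros]:
  "continuous_on UNIV (\<lambda>p :: baire \<times> baire. snd p i)"
  by (rule continuous_on_product_then_coordinatewise[OF continuous_on_snd[OF continuous_on_id]])

lemma continuous_on_baire_coord [continuous_intros]:
  "continuous_on UNIV (\<lambda>x :: baire. x i)"
  by (rule continuous_on_product_then_coordinatewise[OF continuous_on_id])

lemma closed_Int_Sigma11:
  assumes "closed A" "B \<in> Sigma11"
  shows "A \<inter> B \<in> Sigma11"
proof -
  obtain C :: "(baire \<times> baire) set" where C: "closed C" "B = fst ` C"
    using assms(2) by (rule Sigma11E)
  have "fst ` (C \<inter> A \<times> UNIV) \<in> Sigma11"
    using assms(1) C(1) by (intro Sigma11I closed_Int closed_Times closed_UNIV)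
  also have "fst ` (C \<inter> A \<times> UNIV) = A \<inter> B"
    unfolding C(2) by (auto intro: rev_image_eqI)
  finally show ?thesis .
qed

lemma closed_in_Sigma11:
  assumes "closed A"
  shows "A \<in> Sigma11"
proof -
  have "fst ` (A \<times> (UNIV :: baire set)) \<in> Sigma11"
    using assms by (intro Sigma11I closed_Times closed_UNIV)
  then show ?thesis
    by simp
qed

text \<open>The first coordinate of the witness selects the set of the union.\<close>

lemma Sigma11_UN:
  assumes "\<And>n :: nat. A n \<in> Sigma11"
  shows "(\<Union>n. A n) \<in> Sigma11"
proof -
  have "\<forall>n. \<exists>C :: (baire \<times> baire) set. closed C \<and> A n = fst ` C"
    using assms by (meson Sigma11E)
  then obtain C :: "nat \<Rightarrow> (baire \<times> baire) set" where C: "\<And>n. closed (C n)" "\<And>n. A n = fst ` C n"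
    by metis
  define g :: "baire \<times> baire \<Rightarrow> baire \<times> baire" where "g p = (fst p, \<lambda>k. snd p (Suc k))" for p
  have "continuous_on UNIV g"
    unfolding g_def by (intro continuous_intros continuous_on_coordinatewise_then_product)
  then have "closed (g -` C n)" for n
    using C(1) by (rule closed_vimage[rotated])
  \<comment> \<open>Expressing the selection as a universal over \<open>n\<close> with an open
    premise presents the set as an intersection of closed sets.\<close>
  then have "closed {p. \<forall>n. snd p 0 = n \<longrightarrow> p \<in> g -` C n}"
    by (intro closed_Collect_all closed_Collect_imp open_Collect_nat_eq continuous_intros)
      (simp add: vimage_def)
  then have "fst ` {p. \<forall>n. snd p 0 = n \<longrightarrow> p \<in> g -` C n} \<in> Sigma11"
    by (rule Sigma11I)
  also have "fst ` {p. \<forall>n. snd p 0 = n \<longrightarrow> p \<in> g -` C n} = (\<Union>n. A n)"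
  proof (intro set_eqI iffI)
    fix x
    assume "x \<in> (\<Union>n. A n)"
    then obtain n y where "(x, y) \<in> C n"
      using C(2) by auto
    then have "(x, case_nat n y) \<in> {p. \<forall>n. snd p 0 = n \<longrightarrow> p \<in> g -` C n}"
      by (simp add: g_def)
    then show "x \<in> fst ` {p. \<forall>n. snd p 0 = n \<longrightarrow> p \<in> g -` C n}"
      by (rule rev_image_eqI) simp
  next
    fix x
    assume "x \<in> fst ` {p. \<forall>n. snd p 0 = n \<longrightarrow> p \<in> g -` C n}"
    then obtain y where "g (x, y) \<in> C (y 0)"
      by auto
    then have "x \<in> A (y 0)"
      unfolding C(2) g_def by (rule rev_image_eqI) simp
    then show "x \<in> (\<Union>n. A n)"
      by blast
  qed
  finally show ?thesis .
qed

text \<open>Passes from unions over \<open>nat\<close> to countable index sets, for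
  \<open>Sigma11\<close> and \<open>Sigma01_PS\<close> alike. An empty index set cannot be
  enumerated by \<open>nat\<close>, hence the premise on \<open>{}\<close>.\<close>

lemma UN_countable_closure:
  assumes "countable I" "\<And>i. i \<in> I \<Longrightarrow> A i \<in> \<F>" "{} \<in> \<F>"
    and "\<And>B :: nat \<Rightarrow> 'a set. (\<And>n. B n \<in> \<F>) \<Longrightarrow> (\<Union>n. B n) \<in> \<F>"
  shows "(\<Union>i\<in>I. A i) \<in> \<F>"
proof (cases "I = {}")
  case False
  then have "(\<Union>i\<in>I. A i) = (\<Union>n. A (from_nat_into I n))"
    using range_from_nat_into[OF False assms(1)] by (metis image_image)
  also have "\<dots> \<in> \<F>"
    using False by (intro assms(4) assms(2) from_nat_into)
  finally show ?thesis .
qed (simp add: assms(3))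

lemma empty_Sigma11: "{} \<in> Sigma11"
  by (simp add: closed_in_Sigma11)

lemma UNIV_Sigma11: "UNIV \<in> Sigma11"
  by (simp add: closed_in_Sigma11)

lemma Sigma11_countable_UN:
  assumes "countable I" "\<And>i. i \<in> I \<Longrightarrow> A i \<in> Sigma11"
  shows "(\<Union>i\<in>I. A i) \<in> Sigma11"
  using assms by (rule UN_countable_closure) (auto intro: empty_Sigma11 Sigma11_UN)

lemma Sigma11_Un:
  assumes "A \<in> Sigma11" "B \<in> Sigma11"
  shows "A \<union> B \<in> Sigma11"
  using Sigma11_countable_UN[of "{A, B}" "\<lambda>X. X"] assms by auto

lemma Pi11_countable_INT:
  assumes "countable I" "\<And>i. i \<in> I \<Longrightarrow> A i \<in> Pi11"
  shows "(\<Inter>i\<in>I. A i) \<in> Pi11"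
  using Sigma11_countable_UN[of I "\<lambda>i. - A i"] assms by (simp add: Pi11_def)

abbreviation "Sigma01_PS \<equiv> Sigma01 (Pi11 \<union> Sigma11)"

lemma Sigma11_in: "A \<in> Sigma11 \<Longrightarrow> A \<in> Sigma01_PS"
  and Pi11_in: "A \<in> Pi11 \<Longrightarrow> A \<in> Sigma01_PS"
  by (auto intro: Sigma01.base)

lemma Sigma01_countable_UN:
  assumes "countable I" "\<And>i. i \<in> I \<Longrightarrow> A i \<in> Sigma01_PS"
  shows "(\<Union>i\<in>I. A i) \<in> Sigma01_PS"
  using assms
  by (rule UN_countable_closure) (auto intro: Sigma11_in[OF empty_Sigma11] Sigma01.countable_Union)

lemma Sigma01_Un:
  assumes "A \<in> Sigma01_PS" "B \<in> Sigma01_PS"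
  shows "A \<union> B \<in> Sigma01_PS"
  using Sigma01_countable_UN[of "{A, B}" "\<lambda>X. X"] assms by auto

section \<open>The inclusion\<close>

lemma countable_atMost_omega1: "countable {..\<xi> :: omega1}"
  using countable_lessThan_omega1[of "ord_suc \<xi>"]
  by (simp add: less_ord_suc_iff lessThan_def atMost_def)

lemma Diff_star_subset_Delta01: "Diff_star Pi11 \<subseteq> Delta01 (Pi11 \<union> Sigma11)"
proof
  fix A
  assume "A \<in> Diff_star Pi11"
  then obtain \<xi> B where A: "A = Diff_op \<xi> B"
    and Pi: "\<forall>\<eta><\<xi>. B \<eta> \<in> Pi11"
    and dec: "\<forall>\<eta> \<zeta>. \<eta> \<le> \<zeta> \<and> \<zeta> < \<xi> \<longrightarrow> B \<zeta> \<subseteq> B \<eta>"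
    by (rule Diff_starE)
  have Pi': "(B(\<xi> := {})) \<eta> \<in> Pi11" if "\<eta> \<le> \<xi>" for \<eta>
    using that Pi UNIV_Sigma11 by (auto simp: Pi11_def)
  \<comment> \<open>The points whose first exit is at \<open>\<eta>\<close>: a countable
    intersection of coanalytic sets cut with an analytic set.\<close>
  define D where "D \<eta> = (\<Inter>\<zeta>\<in>{..<\<eta>}. B \<zeta>) \<inter> - (B(\<xi> := {})) \<eta>" for \<eta>
  have D: "D \<eta> \<in> Sigma01_PS" if "\<eta> \<le> \<xi>" for \<eta>
    unfolding D_def
    using that Pi Pi'[OF that] countable_lessThan_omega1
    by (intro Sigma01.Inter Pi11_in[OF Pi11_countable_INT] Sigma11_in)
      (auto simp: Compl_Sigma11_iff)
  have D_iff: "x \<in> A \<longleftrightarrow> \<not> ord_even \<eta>" if "x \<in> D \<eta>" "\<eta> \<le> \<xi>" for x \<eta>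
    unfolding A by (rule mem_Diff_op_iff[OF dec]) (use that in \<open>auto simp: D_def\<close>)
  have D_cover: "\<exists>\<eta>\<le>\<xi>. x \<in> D \<eta>" for x
  proof -
    obtain \<eta> where "x \<notin> (B(\<xi> := {})) \<eta>" "\<eta> \<le> \<xi>" "\<forall>\<zeta><\<eta>. x \<in> B \<zeta>"
      by (rule first_exit_exists)
    then have "x \<in> D \<eta>"
      unfolding D_def by blast
    then show ?thesis
      using \<open>\<eta> \<le> \<xi>\<close> by blast
  qed
  \<comment> \<open>The sets \<open>D \<eta>\<close> with \<open>\<eta> \<le> \<xi>\<close> cover
    the space, and \<open>D_iff\<close> sorts them by parity.\<close>
  have "A = (\<Union>\<eta>\<in>{\<eta>. \<eta> \<le> \<xi> \<and> \<not> ord_even \<eta>}. D \<eta>)"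
    and "- A = (\<Union>\<eta>\<in>{\<eta>. \<eta> \<le> \<xi> \<and> ord_even \<eta>}. D \<eta>)"
    by (auto simp: D_iff dest: D_iff) (meson D_cover D_iff)+
  moreover have "countable {\<eta>. \<eta> \<le> \<xi> \<and> P \<eta>}" for P
    by (rule countable_subset[OF _ countable_atMost_omega1[of \<xi>]]) auto
  ultimately show "A \<in> Delta01 (Pi11 \<union> Sigma11)"
    unfolding Delta01_def using D by (auto intro!: Sigma01_countable_UN)
qed

section \<open>The diagonal set\<close>

text \<open>
  A point \<open>z\<close> codes the relation \<open>bit z 0\<close> on the natural numbers, the colouring
  \<open>\<lambda>n. bit z 1 n 0\<close> and, relative to an enumerated base \<open>G\<close> of the topology, the sequence of
  analytic sets \<open>analytic_set G {k. bit z 2 n k}\<close>.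
\<close>

definition bit :: "baire \<Rightarrow> nat \<Rightarrow> nat \<Rightarrow> nat \<Rightarrow> bool" where
  "bit z i m n \<longleftrightarrow> z (to_nat (i, m, n)) = 1"

definition analytic_set :: "(nat \<Rightarrow> (baire \<times> baire) set) \<Rightarrow> nat set \<Rightarrow> baire set" where
  "analytic_set G K = fst ` (- (\<Union>k\<in>K. G k))"

text \<open>Here \<open>z\<close> is tested against the analytic sets that it codes itself; this is
  the diagonal step.\<close>

definition diag_section :: "(nat \<Rightarrow> (baire \<times> baire) set) \<Rightarrow> nat \<Rightarrow> baire set" where
  "diag_section G n = {z. z \<in> analytic_set G {k. bit z 2 n k}}"

text \<open>A relation without infinite descent that compares any two distinct numbers is a strict
  well-order: a loop or a failure of transitivity would produce a cycle, hence a descending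
  chain.\<close>

definition not_wellorder :: "baire set" where
  "not_wellorder =
     {z. (\<exists>f. \<forall>k. bit z 0 (f (Suc k)) (f k)) \<or>
         (\<exists>m n. m \<noteq> n \<and> \<not> bit z 0 m n \<and> \<not> bit z 0 n m)}"

text \<open>The coded analytic sets stand for the complements of a coanalytic sequence, so
  membership means that \<open>z\<close> is omitted at \<open>n\<close> and at no predecessor of
  \<open>n\<close>.\<close>

definition first_in :: "(nat \<Rightarrow> (baire \<times> baire) set) \<Rightarrow> nat \<Rightarrow> baire set" where
  "first_in G n = diag_section G n \<inter> - (\<Union>m. {z. bit z 0 m n} \<inter> diag_section G m)"

definition diag :: "(nat \<Rightarrow> (baire \<times> baire) set) \<Rightarrow> baire set" where
  "diag G = - not_wellorder \<inter> (\<Union>n. {z. bit z 1 n 0} \<inter> first_in G n)"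

lemma bit_surj: "\<exists>z. \<forall>i m n. bit z i m n = Q i m n"
  by (rule exI[of _ "\<lambda>k. case from_nat k of (i, m, n) \<Rightarrow> if Q i m n then 1 else 0"])
    (simp add: bit_def)

text \<open>The complement of the closed set that projects to \<open>A\<close> is a union of basic
  open sets, and \<open>K\<close> lists them.\<close>

lemma ex_analytic_set:
  assumes "A \<in> Sigma11" "\<And>S. open S \<Longrightarrow> \<exists>K. S = (\<Union>k\<in>K. G k)"
  shows "\<exists>K. A = analytic_set G K"
proof -
  obtain C :: "(baire \<times> baire) set" where C: "closed C" "A = fst ` C"
    using assms(1) by (rule Sigma11E)
  obtain K where "- C = (\<Union>k\<in>K. G k)"
    using assms(2)[OF open_Compl[OF C(1)]] by blast
  then have "A = analytic_set G K"
    unfolding C(2) analytic_set_def by (metis double_complement)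
  then show ?thesis
    by blast
qed

section \<open>Complexity of the diagonal set\<close>

lemma bit_in_Sigma11: "{z. bit z i m n} \<in> Sigma11" "{z. \<not> bit z i m n} \<in> Sigma11"
  unfolding bit_def
  by (intro closed_in_Sigma11 closed_Collect_nat_eq closed_Collect_nat_neq continuous_intros)+

lemma closed_bit: "closed {z. bit z i m n}"
  unfolding bit_def by (intro closed_Collect_nat_eq continuous_intros)

text \<open>The first coordinate serves both as code and as argument. Reading a bit is an open
  condition, so the pairs avoiding all coded basic sets form a closed set, which is then
  projected.\<close>

lemma diag_section_Sigma11:
  assumes "\<And>k. open (G k)"
  shows "diag_section G n \<in> Sigma11"
proof -
  let ?C = "{p. \<forall>k. bit (fst p) 2 n k \<longrightarrow> p \<in> - G k}"
  have "closed (- G k)" for k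
    using assms by (simp add: closed_Compl)
  then have "closed ?C"
    unfolding bit_def
    by (intro closed_Collect_all closed_Collect_imp open_Collect_nat_eq continuous_intros)
      (simp only: Collect_mem_eq)
  moreover have "diag_section G n = fst ` ?C"
    unfolding diag_section_def analytic_set_def by (force simp: image_iff)
  ultimately show ?thesis
    by (simp add: Sigma11I)
qed

lemma not_wellorder_Sigma11: "not_wellorder \<in> Sigma11"
proof -
  \<comment> \<open>The second coordinate carries a descending chain. Quantifying over its values
    \<open>a\<close> and \<open>b\<close> makes the bit be read at a fixed coordinate of
    \<open>fst p\<close>, so each condition is visibly closed.\<close>
  let ?C = "{p :: baire \<times> baire. \<forall>k a b. snd p (Suc k) = a \<longrightarrow> snd p k = b \<longrightarrow> bit (fst p) 0 a b}"
  let ?T = "\<lambda>(m, n). {z. \<not> bit z 0 m n \<and> \<not> bit z 0 n m}"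
  have "closed ?C"
    unfolding bit_def
    by (intro closed_Collect_all closed_Collect_imp open_Collect_nat_eq closed_Collect_nat_eq
        continuous_intros)
  then have "fst ` ?C \<in> Sigma11"
    by (rule Sigma11I)
  moreover have "?T mn \<in> Sigma11" for mn
  proof -
    obtain m n where "mn = (m, n)"
      by fastforce
    moreover have "closed {z. \<not> bit z 0 m n \<and> \<not> bit z 0 n m}"
      unfolding bit_def by (intro closed_Collect_conj closed_Collect_nat_neq continuous_intros)
    ultimately show ?thesis
      by (simp add: closed_in_Sigma11)
  qed
  ultimately have "fst ` ?C \<union> (\<Union>mn\<in>{(m, n). m \<noteq> n}. ?T mn) \<in> Sigma11"
    by (intro Sigma11_Un Sigma11_countable_UN) auto
  moreover have "not_wellorder = fst ` ?C \<union> (\<Union>mn\<in>{(m, n). m \<noteq> n}. ?T mn)"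
    unfolding not_wellorder_def by (force simp: image_iff)
  ultimately show ?thesis
    by simp
qed

lemma first_in_subset: "first_in G n \<subseteq> diag_section G n"
  unfolding first_in_def by blast

lemma first_in_Sigma01:
  assumes "\<And>k. open (G k)"
  shows "first_in G n \<in> Sigma01_PS"
proof -
  have "diag_section G n \<in> Sigma01_PS"
    by (rule Sigma11_in[OF diag_section_Sigma11[OF assms]])
  moreover have "{z. bit z 0 m n} \<inter> diag_section G m \<in> Sigma11" for m
    by (rule closed_Int_Sigma11[OF closed_bit diag_section_Sigma11[OF assms]])
  then have "- (\<Union>m. {z. bit z 0 m n} \<inter> diag_section G m) \<in> Sigma01_PS"
    by (intro Pi11_in Compl_Pi11_iff[THEN iffD2] Sigma11_UN)
  ultimately show ?thesis
    unfolding first_in_def by (rule Sigma01.Inter)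
qed

text \<open>Of two distinct numbers one precedes the other, which prevents the later one from being
  first.\<close>

lemma first_in_unique:
  assumes "z \<notin> not_wellorder" "z \<in> first_in G m" "z \<in> first_in G n"
  shows "m = n"
  using assms unfolding not_wellorder_def first_in_def by blast

lemma first_in_exists:
  assumes "z \<notin> not_wellorder" "z \<in> diag_section G k"
  shows "\<exists>n. z \<in> first_in G n"
proof -
  have "wf {(m, n). bit z 0 m n}"
    using assms(1) unfolding not_wellorder_def wf_iff_no_infinite_down_chain by blast
  moreover have "k \<in> {n. z \<in> diag_section G n}"
    using assms(2) by simp
  ultimately obtain n where "n \<in> {n. z \<in> diag_section G n}"
    "\<And>m. (m, n) \<in> {(m, n). bit z 0 m n} \<Longrightarrow> m \<notin> {n. z \<in> diag_section G n}"
    by (rule wfE_min) blast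
  then show ?thesis
    by (auto simp: first_in_def)
qed

lemma diag_Delta01:
  assumes "\<And>k. open (G k)"
  shows "diag G \<in> Delta01 (Pi11 \<union> Sigma11)"
proof -
  have first: "{z. bit z 1 n 0} \<inter> first_in G n \<in> Sigma01_PS"
    "{z. \<not> bit z 1 n 0} \<inter> first_in G n \<in> Sigma01_PS" for n
    by (intro Sigma01.Inter Sigma11_in[OF bit_in_Sigma11(1)] Sigma11_in[OF bit_in_Sigma11(2)]
        first_in_Sigma01 assms)+
  have wo: "- not_wellorder \<in> Sigma01_PS"
    by (simp add: Pi11_in not_wellorder_Sigma11)
  have "diag G \<in> Sigma01_PS"
    unfolding diag_def by (intro Sigma01.Inter Sigma01.countable_Union first wo)
  \<comment> \<open>A point outside \<open>diag G\<close> codes no well-order, lies in none of its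
    coded sets, or first meets them at a number coloured odd. Uniqueness of that number keeps the
    last case disjoint from \<open>diag G\<close>.\<close>
  moreover have "- diag G = not_wellorder \<union> - (\<Union>n. diag_section G n) \<union>
    - not_wellorder \<inter> (\<Union>n. {z. \<not> bit z 1 n 0} \<inter> first_in G n)" (is "_ = ?R")
  proof (intro set_eqI iffI)
    fix z
    assume z: "z \<in> - diag G"
    show "z \<in> ?R"
    proof (cases "z \<in> not_wellorder \<or> z \<notin> (\<Union>n. diag_section G n)")
      case False
      then obtain n where "z \<in> first_in G n"
        using first_in_exists[of z G] by blast
      with z False show ?thesis
        unfolding diag_def by blast
    qed blast
  next
    fix z
    assume "z \<in> ?R"
    then show "z \<in> - diag G"
      using first_in_unique[of z G] first_in_subset[of G] unfolding diag_def by blast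
  qed
  moreover have "?R \<in> Sigma01_PS"
    by (intro Sigma01_Un Sigma01.Inter Sigma01.countable_Union first wo Sigma11_in[OF not_wellorder_Sigma11]
        Pi11_in Compl_Pi11_iff[THEN iffD2] Sigma11_UN diag_section_Sigma11 assms)
  ultimately show ?thesis
    by (simp add: Delta01_def)
qed

section \<open>Strictness by diagonalisation\<close>

lemma diag_notin_Diff_star:
  assumes base: "\<And>S. open S \<Longrightarrow> \<exists>K. S = (\<Union>k\<in>K. G k)"
  shows "diag G \<notin> Diff_star Pi11"
proof
  assume "diag G \<in> Diff_star Pi11"
  then obtain \<xi> B where A: "diag G = Diff_op \<xi> B"
    and Pi: "\<forall>\<eta><\<xi>. B \<eta> \<in> Pi11"
    and dec: "\<forall>\<eta> \<zeta>. \<eta> \<le> \<zeta> \<and> \<zeta> < \<xi> \<longrightarrow> B \<zeta> \<subseteq> B \<eta>"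
    by (rule Diff_starE)
  let ?B = "B(\<xi> := {})"
  have "\<exists>K. - ?B \<eta> = analytic_set G K" if "\<eta> \<le> \<xi>" for \<eta>
    using that Pi UNIV_Sigma11 by (intro ex_analytic_set base) (auto simp: Pi11_def)
  then obtain K where K: "\<And>\<eta>. \<eta> \<le> \<xi> \<Longrightarrow> - ?B \<eta> = analytic_set G (K \<eta>)"
    by metis
  \<comment> \<open>The enumeration includes \<open>\<xi>\<close>, where \<open>?B\<close> is empty,
    so \<open>z\<close> will lie in at least one coded set.\<close>
  define e where "e = from_nat_into {..\<xi>}"
  have range_e: "range e = {..\<xi>}"
    unfolding e_def by (rule range_from_nat_into) (auto simp: countable_atMost_omega1)
  then have e_le: "e n \<le> \<xi>" for n
    by auto
  \<comment> \<open>\<open>e\<close> need not be injective, so ties are broken by the index.\<close>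
  define W where "W m n \<longleftrightarrow> e m < e n \<or> e m = e n \<and> m < n" for m n
  \<comment> \<open>The code of \<open>B\<close> itself: slot 0 holds the order \<open>W\<close>,
    slot 1 the true parities, slot 2 the codes of the complements.\<close>
  obtain z where z: "\<And>i m n. bit z i m n =
      (if i = 0 then W m n else if i = 1 then ord_even (e m) else n \<in> K (e m))"
    using bit_surj[of "\<lambda>i m n. if i = 0 then W m n else if i = 1 then ord_even (e m) else n \<in> K (e m)"]
    by blast
  have sec: "z \<in> diag_section G n \<longleftrightarrow> z \<notin> ?B (e n)" for n
  proof -
    have "{k. bit z 2 n k} = K (e n)"
      by (simp add: z)
    then show ?thesis
      unfolding diag_section_def mem_Collect_eq by (simp only: K[OF e_le, symmetric] Compl_iff)
  qed
  have wo: "z \<notin> not_wellorder"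
  proof -
    \<comment> \<open>\<open>W\<close> is the lexicographic order pulled back along the injection
      sending \<open>n\<close> to \<open>(e n, n)\<close>.\<close>
    have "wf (inv_image ({(x, y). x < y} <*lex*> {(x, y). x < y}) (\<lambda>n. (e n, n)))"
      by (intro wf_inv_image wf_lex_prod wf)
    moreover have "inv_image ({(x, y). x < y} <*lex*> {(x, y). x < y}) (\<lambda>n. (e n, n)) = {(m, n). W m n}"
      by (auto simp: inv_image_def W_def)
    ultimately have "wf {(m, n). W m n}"
      by simp
    then have "\<not> (\<exists>f. \<forall>k. W (f (Suc k)) (f k))"
      unfolding wf_iff_no_infinite_down_chain by simp
    moreover have "W m n \<or> W n m" if "m \<noteq> n" for m n
      using that unfolding W_def by auto
    ultimately show ?thesis
      unfolding not_wellorder_def by (simp add: z) blast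
  qed
  obtain \<eta> where \<eta>: "z \<notin> ?B \<eta>" "\<eta> \<le> \<xi>" "\<forall>\<zeta><\<eta>. z \<in> B \<zeta>"
    by (rule first_exit_exists)
  \<comment> \<open>The least number naming \<open>\<eta>\<close> is the \<open>W\<close>-least such
    number, so every \<open>W\<close>-predecessor of \<open>n\<close> names an index strictly below
    \<open>\<eta>\<close>.\<close>
  define n where "n = (LEAST n. e n = \<eta>)"
  have "\<exists>n. e n = \<eta>"
    using \<eta>(2) range_e by (metis atMost_iff imageE)
  then have en: "e n = \<eta>"
    unfolding n_def by (rule LeastI_ex)
  have "z \<notin> diag_section G m" if "W m n" for m
  proof -
    have "e m < \<eta>"
      using that not_less_Least[of m "\<lambda>n. e n = \<eta>"] by (auto simp: W_def en n_def[symmetric])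
    then show ?thesis
      using \<eta>(2,3) by (auto simp: sec)
  qed
  then have first: "z \<in> first_in G n"
    using \<eta>(1) by (auto simp: first_in_def z sec en)
  have "z \<in> diag G \<longleftrightarrow> bit z 1 n 0"
    using wo first first_in_unique[OF wo first] unfolding diag_def by blast
  then have "z \<in> diag G \<longleftrightarrow> ord_even \<eta>"
    by (simp add: z en)
  moreover have "z \<in> diag G \<longleftrightarrow> \<not> ord_even \<eta>"
    unfolding A by (rule mem_Diff_op_iff[OF dec \<eta>])
  ultimately show False
    by blast
qed

lemma ex_sequence_basis:
  "\<exists>G :: nat \<Rightarrow> 'a::second_countable_topology set.
     (\<forall>k. open (G k)) \<and> (\<forall>S. open S \<longrightarrow> (\<exists>K. S = (\<Union>k\<in>K. G k)))"
proof -
  obtain \<B> :: "'a set set" where \<B>: "countable \<B>" "\<And>C. C \<in> \<B> \<Longrightarrow> open C"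
    "\<And>S. open S \<Longrightarrow> \<exists>U. U \<subseteq> \<B> \<and> S = \<Union>U"
    by (rule univ_second_countable) blast
  \<comment> \<open>Inserting \<open>{}\<close> makes the base nonempty, as an enumeration by
    \<open>nat\<close> requires.\<close>
  define G where "G = from_nat_into (insert {} \<B>)"
  have range: "range G = insert {} \<B>"
    unfolding G_def by (rule range_from_nat_into) (use \<B>(1) in auto)
  have "open (G k)" for k
    using range \<B>(2) by (metis insertE open_empty rangeI)
  moreover have "\<exists>K. S = (\<Union>k\<in>K. G k)" if S: "open S" for S
  proof -
    obtain U where U: "U \<subseteq> \<B>" "S = \<Union>U"
      using \<B>(3)[OF S] by blast
    then have "U \<subseteq> range G"
      using range by blast
    then have "S = (\<Union>k\<in>G -` U. G k)"
      unfolding U(2) by blast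
    then show ?thesis
      by blast
  qed
  ultimately show ?thesis
    by blast
qed

theorem theorem1p4:
  shows "Diff_star Pi11 \<subset> Delta01 (Pi11 \<union> Sigma11)"
proof -
  obtain G :: "nat \<Rightarrow> (baire \<times> baire) set" where "\<And>k. open (G k)"
    "\<And>S. open S \<Longrightarrow> \<exists>K. S = (\<Union>k\<in>K. G k)"
    using ex_sequence_basis by blast
  then show ?thesis
    using Diff_star_subset_Delta01 diag_Delta01 diag_notin_Diff_star by blast
qed

end
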